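(* Let $G$ be a graph without isolated vertices and let $k$ be a positive integer. Then $G$ is a total $k$-uniform chordal graph if and only if $k$ is even and $G$ is the disjoint union of exactly $k/2$ complete multipartite graphs (each with at least two parts), in each of which at most one part has size greater than 1.
   Context: All graphs are finite and simple. A graph is chordal if it has no induced cycle of length at least 4. A complete multipartite graph has its vertex set partitioned into parts, with two vertices adjacent iff they lie in different parts. $N(v)$ is the set of neighbors of $v$. For a graph $G$ with no isolated vertices, a total dominating set is a set $A\subseteq V(G)$ such that every vertex of $G$ has a neighbor in $A$; $\gamma_t(G)$ is the minimum size of one. A sequence $(v_1,\dots,v_m)$ of distinct vertices is legal if $N(v_i)\setminus\bigcup_{j=1}^{i-1}N(v_j)\neq\emptyset$ for every $i\in\{2,\dots,m\}$; it is a total dominating sequence if moreover $\{v_1,\dots,v_m\}$ is a total dominating set. $\gamma_{gr}^t(G)$ is the maximum length of a total dominating sequence. $G$ is total $k$-uniform if $\gamma_t(G)=\gamma_{gr}^t(G)=k$. *)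

theory Defs
  imports "Graph_Theory.Pair_Digraph" "HOL-Library.Disjoint_Sets"
begin

text \<open>
  Finite simple graphs are modelled by the locale \<open>pair_graph\<close>: a finite vertex set together with
  a symmetric, irreflexive set of arcs, an undirected edge \<open>uv\<close> being the pair of arcs \<open>(u, v)\<close>
  and \<open>(v, u)\<close>.
\<close>

definition neighborhood :: "'a pair_pre_digraph \<Rightarrow> 'a \<Rightarrow> 'a set" where
  "neighborhood G v = {u. (v, u) \<in> parcs G}"

definition no_isolated_vertices :: "'a pair_pre_digraph \<Rightarrow> bool" where
  "no_isolated_vertices G \<longleftrightarrow> (\<forall>v \<in> pverts G. neighborhood G v \<noteq> {})"

text \<open>
  An induced cycle is given by its cyclic list of vertices; two of them are adjacent
  in \<open>G\<close> exactly if they are cyclically consecutive, so there are no chords.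
\<close>

definition induced_cycle :: "'a pair_pre_digraph \<Rightarrow> 'a list \<Rightarrow> bool" where
  "induced_cycle G c \<longleftrightarrow>
     length c \<ge> 3 \<and> distinct c \<and> set c \<subseteq> pverts G \<and>
     (\<forall>i < length c. \<forall>j < length c.
        (c ! i, c ! j) \<in> parcs G \<longleftrightarrow>
          j = Suc i mod length c \<or> i = Suc j mod length c)"

definition chordal :: "'a pair_pre_digraph \<Rightarrow> bool" where
  "chordal G \<longleftrightarrow> \<not> (\<exists>c. induced_cycle G c \<and> length c \<ge> 4)"

definition total_dominating_set :: "'a pair_pre_digraph \<Rightarrow> 'a set \<Rightarrow> bool" where
  "total_dominating_set G A \<longleftrightarrow>
     A \<subseteq> pverts G \<and> (\<forall>v \<in> pverts G. neighborhood G v \<inter> A \<noteq> {})"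

text \<open>
  The sets below are finite if \<open>G\<close> is, and they are non-empty if moreover \<open>G\<close> has no isolated
  vertices; only then are \<open>Min\<close> and \<open>Max\<close> meaningful.
\<close>

definition total_domination_number :: "'a pair_pre_digraph \<Rightarrow> nat" where
  "total_domination_number G = Min (card ` {A. total_dominating_set G A})"

text \<open>List positions start at 0, so the first vertex of the sequence carries no condition.\<close>

definition legal_sequence :: "'a pair_pre_digraph \<Rightarrow> 'a list \<Rightarrow> bool" where
  "legal_sequence G vs \<longleftrightarrow>
     distinct vs \<and> set vs \<subseteq> pverts G \<and>
     (\<forall>i \<in> {1..<length vs}.
        neighborhood G (vs ! i) - (\<Union>j<i. neighborhood G (vs ! j)) \<noteq> {})"

definition total_dominating_sequence :: "'a pair_pre_digraph \<Rightarrow> 'a list \<Rightarrow> bool" where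
  "total_dominating_sequence G vs \<longleftrightarrow>
     legal_sequence G vs \<and> total_dominating_set G (set vs)"

definition grundy_total_domination_number :: "'a pair_pre_digraph \<Rightarrow> nat" where
  "grundy_total_domination_number G = Max (length ` {vs. total_dominating_sequence G vs})"

definition total_uniform :: "nat \<Rightarrow> 'a pair_pre_digraph \<Rightarrow> bool" where
  "total_uniform k G \<longleftrightarrow>
     total_domination_number G = k \<and> grundy_total_domination_number G = k"

definition complete_multipartite :: "'a pair_pre_digraph \<Rightarrow> 'a set set \<Rightarrow> bool" where
  "complete_multipartite H P \<longleftrightarrow>
     pair_graph H \<and> partition_on (pverts H) P \<and>
     (\<forall>u \<in> pverts H. \<forall>v \<in> pverts H.
        (u, v) \<in> parcs H \<longleftrightarrow> \<not> (\<exists>X \<in> P. u \<in> X \<and> v \<in> X))"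

definition is_disjoint_union ::
  "'a pair_pre_digraph \<Rightarrow> 'i set \<Rightarrow> ('i \<Rightarrow> 'a pair_pre_digraph) \<Rightarrow> bool" where
  "is_disjoint_union G I H \<longleftrightarrow>
     disjoint_family_on (\<lambda>i. pverts (H i)) I \<and>
     pverts G = (\<Union>i\<in>I. pverts (H i)) \<and>
     parcs G = (\<Union>i\<in>I. parcs (H i))"

end

theory Submission
  imports Defs
begin

text \<open>
  If all total dominating sequences have the same length, then legal sequences covering the same
  set are equally long, and two legal sequences of equal length whose covered sets are nested cover
  the same set. A chordal graph has a simplicial vertex \<open>v\<close>. For distinct neighbours \<open>u, u'\<close> of \<open>v\<close>
  the sequences \<open>(v, u)\<close> and \<open>(u, u')\<close> therefore both cover \<open>N[u] = N[u'] = C\<close>, and for every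
  \<open>r \<in> C - N(v)\<close> the inclusion \<open>N(v) \<subseteq> N(r)\<close> is an equality. Hence \<open>C\<close> is a component, the join
  of the clique \<open>N(v)\<close> with the independent set \<open>C - N(v)\<close>, and every component arises in this way.
  Conversely, a complete multipartite component contains at least two vertices of every total
  dominating set and at most two of every legal sequence, since two vertices from different parts
  cover it; this also determines the number of components as \<open>k/2\<close>.
\<close>

section \<open>Simplicial vertices of chordal graphs\<close>

text \<open>Among all walks in A with the given ends, a shortest one can have neither a repeated
  vertex nor a chord, since either would allow a shorter walk.\<close>

lemma shortest_walk_induced:
  assumes "successively E p" "p \<noteq> []" "set p \<subseteq> A"
  obtains q where "successively E q" "q \<noteq> []" "set q \<subseteq> A" "hd q = hd p" "last q = last p"
    "distinct q" "\<And>i j. i < j \<Longrightarrow> j < length q \<Longrightarrow> E (q ! i) (q ! j) \<Longrightarrow> j = Suc i"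
proof -
  define walk where "walk q \<longleftrightarrow> successively E q \<and> q \<noteq> [] \<and> set q \<subseteq> A \<and> hd q = hd p \<and> last q = last p"
    for q
  have "walk p" using assms by (simp add: walk_def)
  then obtain q where q: "walk q" and min: "\<And>r. walk r \<Longrightarrow> length q \<le> length r"
    using ex_has_least_nat[of walk p length] by blast
  \<comment> \<open>Cutting out the positions from i to j - 1 serves both uses below: a repeated
    vertex, and a chord with \<open>Suc i\<close> in place of i. For i = 0 nothing precedes the cut,
    so \<open>q ! j\<close> has to be the old head.\<close>
  have shortcut: "walk (take i q @ drop j q)"
    if "i < j" "j < length q" "i = 0 \<Longrightarrow> q ! j = q ! 0" "i > 0 \<Longrightarrow> E (q ! (i - 1)) (q ! j)" for i j
  proof -
    have succ: "successively E (take i q)" "successively E (drop j q)"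
      using q unfolding walk_def by (metis append_take_drop_id successively_append_iff)+
    have ends: "last (take i q) = q ! (i - 1)" if "i > 0"
      using that \<open>i < j\<close> \<open>j < length q\<close> by (subst last_conv_nth) auto
    have "hd (drop j q) = q ! j" using that by (simp add: hd_drop_conv_nth)
    moreover have "set (take i q @ drop j q) \<subseteq> A"
      using q by (auto simp: walk_def dest: in_set_takeD in_set_dropD)
    moreover have "hd (take i q @ drop j q) = hd p"
      using that q by (cases "i = 0") (auto simp: walk_def hd_drop_conv_nth hd_append hd_conv_nth)
    ultimately show ?thesis
      using succ ends that q unfolding walk_def by (cases "i = 0") (auto simp: successively_append_iff)
  qed
  have adj: "E (q ! (i - 1)) (q ! i)" if "i < length q" "i > 0" for i
    using q that successively_conv_nth[of E q] unfolding walk_def by (cases i) auto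
  have neq: "q ! i \<noteq> q ! j" if "i < j" "j < length q" for i j
  proof
    assume eq: "q ! i = q ! j"
    have "walk (take i q @ drop j q)"
      using that eq adj[of i] by (intro shortcut) auto
    from min[OF this] that show False by simp
  qed
  have "distinct q"
    unfolding distinct_conv_nth using neq by (metis linorder_neqE_nat)
  moreover have "j = Suc i" if "i < j" "j < length q" "E (q ! i) (q ! j)" for i j
  proof (rule ccontr)
    assume "j \<noteq> Suc i"
    with that have "walk (take (Suc i) q @ drop j q)" by (intro shortcut) auto
    from min[OF this] that \<open>j \<noteq> Suc i\<close> show False by simp
  qed
  ultimately show ?thesis using that q by (auto simp: walk_def)
qed

text \<open>The bound on \<open>set p\<close> later keeps the walk inside one component.\<close>

lemma walk_of_rtrancl:
  assumes "(a, b) \<in> r\<^sup>*"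
  obtains p where "successively (\<lambda>x y. (x, y) \<in> r) p" "p \<noteq> []" "hd p = a" "last p = b"
    "set p \<subseteq> r\<^sup>* `` {a}"
proof -
  have "\<exists>p. successively (\<lambda>x y. (x, y) \<in> r) p \<and> p \<noteq> [] \<and> hd p = a \<and> last p = b \<and> set p \<subseteq> r\<^sup>* `` {a}"
    using assms
  proof (induction rule: rtrancl_induct)
    case base
    show ?case by (intro exI[of _ "[a]"]) auto
  next
    case (step y z)
    then obtain p where "successively (\<lambda>x y. (x, y) \<in> r) p" "p \<noteq> []" "hd p = a" "last p = y"
      "set p \<subseteq> r\<^sup>* `` {a}" by blast
    with step show ?case
      by (intro exI[of _ "p @ [z]"]) (auto simp: successively_append_iff intro: rtrancl_into_rtrancl)
  qed
  then show thesis using that by blast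
qed

section \<open>Induced cycles and clique separators\<close>

context pair_graph
begin

lemma neighborhood_sym: "u \<in> neighborhood G v \<longleftrightarrow> v \<in> neighborhood G u"
  using arcs_symmetric by (auto simp: neighborhood_def)

lemma neighborhood_irrefl: "v \<notin> neighborhood G v"
  using pair_no_loops[of "(v, v)"] by (auto simp: neighborhood_def)

lemma neighborhood_subset: "neighborhood G v \<subseteq> pverts G"
  using in_arcsD2 by (auto simp: neighborhood_def)

text \<open>Placing x at position 0 shifts the path by one. Indices wrap around only at the last
  vertex of the path, and there \<open>apex\<close> supplies the edge back to x.\<close>

lemma apex_path_induced_cycle:
  assumes p: "distinct p" "set p \<subseteq> pverts G" "length p \<ge> 2"
    and x: "x \<in> pverts G" "x \<notin> set p"
    and path: "\<And>i j. i < j \<Longrightarrow> j < length p \<Longrightarrow> (p ! i, p ! j) \<in> parcs G \<longleftrightarrow> j = Suc i"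
    and apex: "\<And>i. i < length p \<Longrightarrow> (x, p ! i) \<in> parcs G \<longleftrightarrow> i = 0 \<or> Suc i = length p"
  shows "induced_cycle G (x # p)"
proof -
  let ?n = "length p"
  have sym: "(a, b) \<in> parcs G \<longleftrightarrow> (b, a) \<in> parcs G" for a b using arcs_symmetric by blast
  have irr: "(a, a) \<notin> parcs G" for a using pair_no_loops by force
  have upper: "((x # p) ! i, (x # p) ! j) \<in> parcs G \<longleftrightarrow> j = Suc i mod Suc ?n \<or> i = Suc j mod Suc ?n"
    if "i < j" "j \<le> ?n" for i j
  proof (cases i)
    case 0
    with that obtain b where "j = Suc b" by (cases j) auto
    with 0 that p apex[of b] show ?thesis by (auto simp: mod_Suc)
  next
    case (Suc a)
    with that obtain b where "j = Suc b" by (cases j) auto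
    with Suc that p path[of a b] show ?thesis by (auto simp: mod_Suc)
  qed
  have "((x # p) ! i, (x # p) ! j) \<in> parcs G \<longleftrightarrow> j = Suc i mod Suc ?n \<or> i = Suc j mod Suc ?n"
    if "i \<le> ?n" "j \<le> ?n" for i j
  proof (cases i j rule: linorder_cases)
    case less
    then show ?thesis using upper that by blast
  next
    case equal
    then show ?thesis using irr that p(3) by (auto simp: mod_Suc)
  next
    case greater
    then show ?thesis using upper[of j i] that sym by blast
  qed
  then show ?thesis using assms by (auto simp: induced_cycle_def less_Suc_eq_le)
qed

text \<open>If s and t were not adjacent, a shortest walk from s to t through the connected set K
  would have at least three vertices. Since x sees only its ends, x closes it to an induced cycle of
  length at least 4.\<close>

lemma chordal_separator_clique:
  assumes "chordal G" and x: "x \<in> pverts G"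
    and r: "r \<subseteq> parcs G" "sym r"
    and K: "K = r\<^sup>* `` {y}" "K \<subseteq> pverts G" "x \<notin> K" "K \<inter> neighborhood G x = {}"
    and s: "s \<in> neighborhood G x" "neighborhood G s \<inter> K \<noteq> {}"
    and t: "t \<in> neighborhood G x" "neighborhood G t \<inter> K \<noteq> {}"
    and "s \<noteq> t"
  shows "t \<in> neighborhood G s"
proof (rule ccontr)
  assume nadj: "t \<notin> neighborhood G s"
  let ?E = "\<lambda>u v. (u, v) \<in> parcs G"
  have sym: "?E a b \<longleftrightarrow> ?E b a" for a b using arcs_symmetric by blast
  from s t obtain a b where a: "a \<in> K" "?E s a" and b: "b \<in> K" "?E b t"
    using sym by (auto simp: neighborhood_def)
  from a b have "(a, b) \<in> r\<^sup>*"
    unfolding K using sym_rtrancl[OF r(2)] by (auto dest: symD intro: rtrancl_trans)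
  then obtain w where w: "successively (\<lambda>x y. (x, y) \<in> r) w" "w \<noteq> []" "hd w = a" "last w = b"
    "set w \<subseteq> r\<^sup>* `` {a}" by (rule walk_of_rtrancl)
  have "set w \<subseteq> K" using w(5) a unfolding K by (auto intro: rtrancl_trans)
  moreover have "successively ?E w" using w(1) by (rule successively_mono) (use r in auto)
  ultimately have "successively ?E (s # w @ [t])" "s # w @ [t] \<noteq> []" "set (s # w @ [t]) \<subseteq> K \<union> {s, t}"
    using w a b by (auto simp: successively_append_iff successively_Cons)
  then obtain p where p: "successively ?E p" "p \<noteq> []" "set p \<subseteq> K \<union> {s, t}"
      "hd p = s" "last p = t" "distinct p"
      and ind: "\<And>i j. i < j \<Longrightarrow> j < length p \<Longrightarrow> ?E (p ! i) (p ! j) \<Longrightarrow> j = Suc i"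
    by (rule shortest_walk_induced) auto
  have p0: "p ! 0 = s" using p by (simp add: hd_conv_nth)
  have pl: "p ! (length p - 1) = t" using p by (simp add: last_conv_nth)
  have step: "?E (p ! i) (p ! Suc i)" if "Suc i < length p" for i
    using p(1) that by (simp add: successively_conv_nth)
  have len: "length p \<ge> 3"
  proof (rule ccontr)
    assume "\<not> length p \<ge> 3"
    moreover have "length p \<noteq> 0" using p(2) by simp
    ultimately consider "length p = 1" | "length p = 2" by linarith
    then show False using p0 pl \<open>s \<noteq> t\<close> nadj step[of 0] by cases (auto simp: neighborhood_def)
  qed
  have "induced_cycle G (x # p)"
  proof (rule apex_path_induced_cycle)
    show "set p \<subseteq> pverts G" using p(3) K(2) s(1) t(1) neighborhood_subset by blast
    show "x \<notin> set p" using p(3) K(3) s(1) t(1) neighborhood_irrefl by blast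
    show "?E (p ! i) (p ! j) \<longleftrightarrow> j = Suc i" if "i < j" "j < length p" for i j
      using ind[OF that] step[of i] that by auto
    show "?E x (p ! i) \<longleftrightarrow> i = 0 \<or> Suc i = length p" if i: "i < length p" for i
    proof
      assume "?E x (p ! i)"
      then have "p ! i \<notin> K" using K(4) by (auto simp: neighborhood_def)
      then have "p ! i \<in> {s, t}" using p(3) i nth_mem by blast
      then have "p ! i = p ! 0 \<or> p ! i = p ! (length p - 1)" using p0 pl by auto
      then show "i = 0 \<or> Suc i = length p"
        using p(2,6) i nth_eq_iff_index_eq[of p i 0] nth_eq_iff_index_eq[of p i "length p - 1"] by auto
    next
      assume "i = 0 \<or> Suc i = length p"
      then have "p ! i \<in> {s, t}" using p0 pl by (metis diff_Suc_1 insert_iff)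
      then show "?E x (p ! i)" using s(1) t(1) by (auto simp: neighborhood_def)
    qed
  qed (use p len x in auto)
  moreover have "length (x # p) \<ge> 4" using len by simp
  ultimately show False using \<open>chordal G\<close> unfolding chordal_def by blast
qed

text \<open>Relative to W, so that an induction over induced subgraphs can vary W and keep G
  fixed.\<close>

definition simplicial_in :: "'a set \<Rightarrow> 'a \<Rightarrow> bool" where
  "simplicial_in W v \<longleftrightarrow>
     (\<forall>a \<in> neighborhood G v \<inter> W. \<forall>b \<in> neighborhood G v \<inter> W. a \<noteq> b \<longrightarrow> b \<in> neighborhood G a)"

lemma simplicial_in_clique:
  assumes "\<And>z. z \<in> W \<Longrightarrow> W - insert z (neighborhood G z) = {}"
  shows "simplicial_in W v"
  unfolding simplicial_in_def
proof (intro ballI impI)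
  fix a b assume "a \<in> neighborhood G v \<inter> W" "b \<in> neighborhood G v \<inter> W" "a \<noteq> b"
  with assms[of a] show "b \<in> neighborhood G a" by auto
qed

text \<open>
  Dirac's argument: for a component \<open>K\<close> of the graph minus the closed neighbourhood of \<open>x\<close>, the
  attachment set \<open>S\<close> of \<open>K\<close> is a clique, and induction applies to \<open>K \<union> S\<close>, which misses \<open>x\<close>.
\<close>

lemma chordal_simplicial_nonneighbor:
  assumes "chordal G" "W \<subseteq> pverts G" "x \<in> W" "W - insert x (neighborhood G x) \<noteq> {}"
  shows "\<exists>v \<in> W - insert x (neighborhood G x). simplicial_in W v"
  using assms(2-)
proof (induction "card W" arbitrary: W x rule: less_induct)
  case less
  define F where "F = W - insert x (neighborhood G x)"
  \<comment> \<open>Only arcs inside F are kept, so that K becomes the component of y in the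
    subgraph on F.\<close>
  define r where "r = parcs G \<inter> F \<times> F"
  obtain y where y: "y \<in> F" using less.prems F_def by auto
  define K where "K = r\<^sup>* `` {y}"
  define S where "S = {s \<in> W - K. neighborhood G s \<inter> K \<noteq> {}}"
  have KF: "K \<subseteq> F"
  proof
    fix z assume "z \<in> K"
    then have "(y, z) \<in> r\<^sup>*" by (simp add: K_def)
    then show "z \<in> F" using y by cases (auto simp: r_def)
  qed
  have "y \<in> K" by (simp add: K_def)
  have symr: "sym r" using arcs_symmetric by (auto simp: r_def sym_def)
  have SF: "S \<subseteq> neighborhood G x"
  proof
    fix s assume s: "s \<in> S"
    then obtain a where a: "a \<in> K" "a \<in> neighborhood G s" "s \<in> W" "s \<notin> K"
      by (auto simp: S_def)
    have "s \<noteq> x" using a KF by (auto simp: F_def)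
    \<comment> \<open>A vertex of F with a neighbour in K would belong to the component K
      itself.\<close>
    moreover have "s \<notin> F"
    proof
      assume "s \<in> F"
      then have "(a, s) \<in> r" using a KF arcs_symmetric by (auto simp: r_def neighborhood_def)
      then show False using a by (auto simp: K_def intro: rtrancl_into_rtrancl)
    qed
    ultimately show "s \<in> neighborhood G x" using a by (auto simp: F_def)
  qed
  have clique: "t \<in> neighborhood G s" if "s \<in> S" "t \<in> S" "s \<noteq> t" for s t
  proof (rule chordal_separator_clique[OF \<open>chordal G\<close> _ _ symr K_def])
    show "r \<subseteq> parcs G" by (simp add: r_def)
  qed (use that SF KF less.prems in \<open>auto simp: F_def S_def\<close>)
  let ?H = "K \<union> S"
  have HW: "?H \<subseteq> W" using KF by (auto simp: F_def S_def)
  have "x \<notin> ?H" using KF SF neighborhood_irrefl by (auto simp: F_def)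
  then have "card ?H < card W"
    using HW less.prems finite_subset[OF less.prems(1) pair_finite_verts] by (intro psubset_card_mono) auto
  note IH = less.hyps[OF this]
  \<comment> \<open>By definition of S, a vertex of K has no neighbours in W outside
    \<open>?H\<close>.\<close>
  have transfer: "simplicial_in W v" if "v \<in> K" "simplicial_in ?H v" for v
  proof -
    have "neighborhood G v \<inter> W \<subseteq> ?H"
      using that(1) neighborhood_sym by (auto simp: S_def)
    then show ?thesis using that(2) unfolding simplicial_in_def by blast
  qed
  have "\<exists>v \<in> K. simplicial_in ?H v"
  proof (cases "\<exists>z \<in> ?H. ?H - insert z (neighborhood G z) \<noteq> {}")
    case True
    \<comment> \<open>A vertex z of S is preferred; z lies in K only if every vertex of S is
      adjacent to all of \<open>?H\<close>. Either way no vertex of S is a non-neighbour of z other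
      than z itself, so the v found by induction lies in K.\<close>
    then obtain z where z: "z \<in> ?H" "?H - insert z (neighborhood G z) \<noteq> {}"
      "z \<in> S \<or> (\<forall>s \<in> S. ?H - insert s (neighborhood G s) = {})" by blast
    obtain v where v: "v \<in> ?H - insert z (neighborhood G z)" "simplicial_in ?H v"
      using IH[OF _ z(1,2)] HW less.prems by blast
    have "v \<notin> S"
    proof
      assume "v \<in> S"
      from z(3) show False
      proof
        assume "z \<in> S"
        then show False using v clique \<open>v \<in> S\<close> by blast
      next
        assume "\<forall>s \<in> S. ?H - insert s (neighborhood G s) = {}"
        then have "z \<in> insert v (neighborhood G v)" using \<open>v \<in> S\<close> z(1) by blast
        then show False using v(1) neighborhood_sym by blast
      qed
    qed
    then show ?thesis using v by blast
  next
    case False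
    then have "simplicial_in ?H y" by (intro simplicial_in_clique) simp
    then show ?thesis using \<open>y \<in> K\<close> by blast
  qed
  then show ?case using transfer KF unfolding F_def by blast
qed

lemma chordal_simplicial:
  assumes "chordal G" "W \<subseteq> pverts G" "W \<noteq> {}"
  shows "\<exists>v \<in> W. simplicial_in W v"
proof (cases "\<exists>x \<in> W. W - insert x (neighborhood G x) \<noteq> {}")
  case True
  then show ?thesis using chordal_simplicial_nonneighbor assms by blast
next
  case False
  then have "simplicial_in W v" for v by (intro simplicial_in_clique) simp
  then show ?thesis using assms(3) by blast
qed

end

section \<open>Legal sequences\<close>

locale graph_without_isolated = pair_graph +
  assumes no_isolated: "no_isolated_vertices G"
begin

abbreviation covered :: "'a list \<Rightarrow> 'a set" where
  "covered vs \<equiv> \<Union> (neighborhood G ` set vs)"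

lemma legal_sequence_Nil: "legal_sequence G []"
  by (simp add: legal_sequence_def)

text \<open>Makes legality a uniform recursion: without isolated vertices the first vertex always
  covers something, and a repeated vertex covers nothing new, so distinctness comes for
  free.\<close>

lemma legal_sequence_snoc:
  "legal_sequence G (vs @ [w]) \<longleftrightarrow>
     legal_sequence G vs \<and> w \<in> pverts G \<and> \<not> neighborhood G w \<subseteq> covered vs"
proof -
  let ?new = "\<lambda>vs i. neighborhood G (vs ! i) - (\<Union>j<i. neighborhood G (vs ! j)) \<noteq> {}"
  have old: "?new (vs @ [w]) i \<longleftrightarrow> ?new vs i" if "i < length vs" for i
    using that by (simp add: nth_append)
  have cov: "(\<Union>j<length vs. neighborhood G ((vs @ [w]) ! j)) = covered vs"
    by (auto simp: nth_append set_conv_nth)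
  have last: "?new (vs @ [w]) (length vs) \<longleftrightarrow> \<not> neighborhood G w \<subseteq> covered vs"
    unfolding cov by auto
  have range: "(\<forall>i\<in>{1..<length (vs @ [w])}. ?new (vs @ [w]) i) \<longleftrightarrow>
      (\<forall>i\<in>{1..<length vs}. ?new vs i) \<and> (vs = [] \<or> ?new (vs @ [w]) (length vs))"
  proof (cases "vs = []")
    case False
    then have "{1..<length (vs @ [w])} = insert (length vs) {1..<length vs}"
      by (auto simp: less_Suc_eq Suc_le_eq)
    then show ?thesis using old False by auto
  qed auto
  have "vs = [] \<Longrightarrow> w \<in> pverts G \<Longrightarrow> \<not> neighborhood G w \<subseteq> covered vs"
    using no_isolated by (auto simp: no_isolated_vertices_def)
  moreover have "\<not> neighborhood G w \<subseteq> covered vs \<Longrightarrow> w \<notin> set vs" by auto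
  ultimately show ?thesis
    unfolding legal_sequence_def range last by auto
qed

lemma legal_sequence_single: "v \<in> pverts G \<Longrightarrow> legal_sequence G [v]"
  using legal_sequence_snoc[of "[]" v] no_isolated
  by (auto simp: legal_sequence_Nil no_isolated_vertices_def)

text \<open>The vertex v does not cover itself, but u covers it.\<close>

lemma legal_sequence_edge:
  assumes "u \<in> neighborhood G v"
  shows "legal_sequence G [v, u]"
proof -
  have "v \<in> neighborhood G u - neighborhood G v"
    using assms neighborhood_sym neighborhood_irrefl by blast
  moreover have "v \<in> pverts G" "u \<in> pverts G"
    using assms neighborhood_subset neighborhood_sym by blast+
  ultimately show ?thesis
    using legal_sequence_snoc[of "[v]" u] legal_sequence_single by auto
qed

text \<open>What an entry of \<open>zs\<close> newly covers after \<open>ys\<close> is also new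
  after \<open>xs\<close>, because less has been covered before.\<close>

lemma legal_sequence_append_mono:
  assumes "legal_sequence G (ys @ zs)" "legal_sequence G xs" "covered xs \<subseteq> covered ys"
  shows "legal_sequence G (xs @ zs)"
  using assms(1)
proof (induction zs rule: rev_induct)
  case Nil
  then show ?case using assms(2) by simp
next
  case (snoc z zs)
  then have "legal_sequence G (ys @ zs)" "z \<in> pverts G" "\<not> neighborhood G z \<subseteq> covered (ys @ zs)"
    using legal_sequence_snoc[of "ys @ zs" z] by auto
  moreover have "covered (xs @ zs) \<subseteq> covered (ys @ zs)" using assms(3) by auto
  ultimately show ?case
    using snoc.IH legal_sequence_snoc[of "xs @ zs" z] by (metis append_assoc order_trans)
qed

lemma legal_sequence_length_le:
  assumes "legal_sequence G vs"
  shows "length vs \<le> card (pverts G)"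
  using assms unfolding legal_sequence_def
  by (metis card_mono distinct_card pair_finite_verts)

text \<open>Greedy completion: as long as some x is uncovered, any neighbour of x may be appended,
  and legal sequences have bounded length.\<close>

lemma legal_sequence_extend:
  assumes "legal_sequence G vs"
  shows "\<exists>us. total_dominating_sequence G (vs @ us)"
  using assms
proof (induction "card (pverts G) - length vs" arbitrary: vs rule: less_induct)
  case less
  show ?case
  proof (cases "pverts G \<subseteq> covered vs")
    case True
    have "neighborhood G v \<inter> set vs \<noteq> {}" if v: "v \<in> pverts G" for v
    proof -
      obtain w where "w \<in> set vs" "v \<in> neighborhood G w" using True v by blast
      then show ?thesis using neighborhood_sym[of v w] by blast
    qed
    moreover have "set vs \<subseteq> pverts G" using less.prems by (simp add: legal_sequence_def)
    ultimately have "total_dominating_set G (set vs)" by (simp add: total_dominating_set_def)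
    then show ?thesis
      using less.prems by (intro exI[of _ "[]"]) (simp add: total_dominating_sequence_def)
  next
    case False
    then obtain x where x: "x \<in> pverts G" "x \<notin> covered vs" by auto
    then obtain w where w: "w \<in> neighborhood G x"
      using no_isolated by (auto simp: no_isolated_vertices_def)
    then have "x \<in> neighborhood G w" "w \<in> pverts G"
      using neighborhood_sym neighborhood_subset by blast+
    then have legal: "legal_sequence G (vs @ [w])"
      using x less.prems legal_sequence_snoc by blast
    then have "card (pverts G) - length (vs @ [w]) < card (pverts G) - length vs"
      using legal_sequence_length_le by fastforce
    from less.hyps[OF this legal] show ?thesis by auto
  qed
qed

section \<open>Total uniformity and the lengths of legal sequences\<close>

lemma finite_total_dominating_sets: "finite {A. total_dominating_set G A}"
  by (rule finite_subset[of _ "Pow (pverts G)"])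
     (auto simp: total_dominating_set_def pair_finite_verts)

lemma finite_total_dominating_sequences: "finite {vs. total_dominating_sequence G vs}"
proof (rule finite_subset)
  show "{vs. total_dominating_sequence G vs} \<subseteq>
      {vs. set vs \<subseteq> pverts G \<and> length vs \<le> card (pverts G)}"
    using legal_sequence_length_le
    by (auto simp: total_dominating_sequence_def legal_sequence_def)
qed (rule finite_lists_length_le[OF pair_finite_verts])

text \<open>A greedily completed sequence is squeezed between the two bounds, so it attains both the
  minimum and the maximum.\<close>

lemma total_uniformI:
  assumes "\<And>A. total_dominating_set G A \<Longrightarrow> n \<le> card A"
    and "\<And>vs. legal_sequence G vs \<Longrightarrow> length vs \<le> n"
  shows "total_uniform n G"
proof -
  obtain vs where vs: "total_dominating_sequence G vs"
    using legal_sequence_extend[OF legal_sequence_Nil] by auto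
  have "card (set vs) = length vs" "total_dominating_set G (set vs)" "legal_sequence G vs"
    using vs by (auto simp: total_dominating_sequence_def legal_sequence_def distinct_card)
  then have len: "length vs = n" "card (set vs) = n"
    using assms(1)[of "set vs"] assms(2)[of vs] by auto
  have "total_domination_number G = n"
    unfolding total_domination_number_def
  proof (rule Min_eqI)
    show "n \<in> card ` {A. total_dominating_set G A}"
      using \<open>total_dominating_set G (set vs)\<close> len(2) by blast
  qed (use assms finite_total_dominating_sets in auto)
  moreover have "grundy_total_domination_number G = n"
    unfolding grundy_total_domination_number_def
  proof (rule Max_eqI)
    show "n \<in> length ` {vs. total_dominating_sequence G vs}" using vs len(1) by blast
    show "finite (length ` {vs. total_dominating_sequence G vs})"
      using finite_total_dominating_sequences by (rule finite_imageI)
  qed (use assms(2) in \<open>auto simp: total_dominating_sequence_def\<close>)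
  ultimately show ?thesis by (simp add: total_uniform_def)
qed

text \<open>The entries of the sequence form a total dominating set, so its length lies between the
  two equal numbers.\<close>

lemma total_uniform_length:
  assumes "total_uniform k G" "total_dominating_sequence G vs"
  shows "length vs = k"
proof (rule antisym)
  show "length vs \<le> k"
    using assms finite_total_dominating_sequences
    unfolding total_uniform_def grundy_total_domination_number_def
    by (metis Max_ge finite_imageI imageI mem_Collect_eq)
  have "card (set vs) = length vs" "total_dominating_set G (set vs)"
    using assms(2) by (auto simp: total_dominating_sequence_def legal_sequence_def distinct_card)
  moreover have "k \<le> card (set vs)"
    using assms(1) finite_total_dominating_sets \<open>total_dominating_set G (set vs)\<close>
    unfolding total_uniform_def total_domination_number_def by (metis Min_le finite_imageI imageI mem_Collect_eq)
  ultimately show "k \<le> length vs" by simp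
qed

text \<open>
  In a total uniform graph the covered sets behave like the flats of a matroid whose rank is the
  length of a legal sequence.
\<close>

lemma total_uniform_length_mono:
  assumes "total_uniform k G" "legal_sequence G xs" "legal_sequence G ys" "covered xs \<subseteq> covered ys"
  shows "length xs \<le> length ys"
proof -
  \<comment> \<open>Replacing \<open>ys\<close> by \<open>xs\<close> in a completion of
    \<open>ys\<close> keeps it legal. Completing again gives the same total length k, so
    \<open>xs\<close> cannot exceed \<open>ys\<close>.\<close>
  obtain zs where zs: "total_dominating_sequence G (ys @ zs)"
    using legal_sequence_extend assms by blast
  then have "legal_sequence G (xs @ zs)"
    using legal_sequence_append_mono assms by (auto simp: total_dominating_sequence_def)
  then obtain us where "total_dominating_sequence G ((xs @ zs) @ us)"
    using legal_sequence_extend by blast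
  from total_uniform_length[OF assms(1) this] total_uniform_length[OF assms(1) zs]
  show ?thesis by simp
qed

text \<open>Otherwise some entry of \<open>ys\<close> could be appended to \<open>xs\<close>, giving
  a longer legal sequence that still covers no more than \<open>ys\<close>.\<close>

lemma total_uniform_covered_eq:
  assumes "total_uniform k G" "legal_sequence G xs" "legal_sequence G ys" "covered xs \<subseteq> covered ys"
    and "length xs = length ys"
  shows "covered xs = covered ys"
proof (rule ccontr)
  assume "covered xs \<noteq> covered ys"
  then obtain y where y: "y \<in> set ys" "\<not> neighborhood G y \<subseteq> covered xs" using assms(4) by blast
  then have "legal_sequence G (xs @ [y])"
    using assms(2,3) legal_sequence_snoc[of xs y] by (auto simp: legal_sequence_def[of G ys])
  moreover have "covered (xs @ [y]) \<subseteq> covered ys" using assms(4) y by auto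
  ultimately have "length (xs @ [y]) \<le> length ys"
    using total_uniform_length_mono assms(1,3) by blast
  then show False using assms(5) by simp
qed

section \<open>Complete multipartite components\<close>

text \<open>Stated through neighbourhoods in G: one equation says both that C is complete
  multipartite and that no edge leaves C.\<close>

definition multipartite_component :: "'a set \<Rightarrow> 'a set set \<Rightarrow> bool" where
  "multipartite_component C P \<longleftrightarrow>
     C \<subseteq> pverts G \<and> partition_on C P \<and> (\<forall>X \<in> P. \<forall>u \<in> X. neighborhood G u = C - X)"

lemma multipartite_component_neighborhood:
  assumes "multipartite_component C P" "u \<in> C"
  obtains X where "X \<in> P" "u \<in> X" "X \<subseteq> C" "neighborhood G u = C - X"
proof -
  have part: "partition_on C P" and nbh: "\<forall>X \<in> P. \<forall>u \<in> X. neighborhood G u = C - X"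
    using assms(1) by (auto simp: multipartite_component_def)
  have "u \<in> \<Union>P" using part assms(2) by (simp add: partition_on_def)
  then obtain X where "X \<in> P" "u \<in> X" by blast
  moreover have "X \<subseteq> C" using part \<open>X \<in> P\<close> by (auto simp: partition_on_def)
  ultimately show ?thesis using nbh that[of X] by simp
qed

text \<open>A vertex of C has a neighbour a in A, and a in turn has a neighbour in A; neither step
  leaves C.\<close>

lemma multipartite_component_dominating:
  assumes "multipartite_component C P" "C \<noteq> {}" "total_dominating_set G A"
  shows "2 \<le> card (A \<inter> C)"
proof -
  have inside: "\<exists>a \<in> neighborhood G c. a \<in> A \<inter> C" if c: "c \<in> C" for c
  proof -
    obtain X where "neighborhood G c = C - X"
      using multipartite_component_neighborhood[OF assms(1) c] by metis
    moreover have "c \<in> pverts G" using assms(1) c by (auto simp: multipartite_component_def)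
    then have "neighborhood G c \<inter> A \<noteq> {}" using assms(3) by (simp add: total_dominating_set_def)
    ultimately show ?thesis by blast
  qed
  obtain c where "c \<in> C" using assms(2) by auto
  then obtain a where a: "a \<in> A \<inter> C" using inside by blast
  then obtain b where b: "b \<in> neighborhood G a" "b \<in> A \<inter> C" using inside by blast
  then have "a \<noteq> b" using neighborhood_irrefl by auto
  then have "card {a, b} = 2" by simp
  moreover have "finite (A \<inter> C)"
    using assms(3) finite_subset[OF _ pair_finite_verts] by (auto simp: total_dominating_set_def)
  ultimately show ?thesis using a b card_mono[of "A \<inter> C" "{a, b}"] by auto
qed

lemma multipartite_component_legal:
  assumes C: "multipartite_component C P" and "legal_sequence G vs"
  shows "card (set vs \<inter> C) \<le> 2"
proof -
  \<comment> \<open>The induction must also record that two entries in C cover it, which makes a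
    third entry illegal. The two lie in different parts, as vertices of one part have equal
    neighbourhoods.\<close>
  have "card (set vs \<inter> C) \<le> 1 \<or> card (set vs \<inter> C) = 2 \<and> C \<subseteq> covered vs"
    using assms(2)
  proof (induction vs rule: rev_induct)
    case Nil
    then show ?case by simp
  next
    case (snoc w vs)
    then have vs: "legal_sequence G vs" and w: "\<not> neighborhood G w \<subseteq> covered vs"
      using legal_sequence_snoc by auto
    show ?case
    proof (cases "w \<in> C")
      case False
      then have "set (vs @ [w]) \<inter> C = set vs \<inter> C" by auto
      then show ?thesis using snoc.IH[OF vs] by auto
    next
      case True
      then obtain Y where Y: "Y \<in> P" "w \<in> Y" "neighborhood G w = C - Y"
        using multipartite_component_neighborhood[OF C] by metis
      have ins: "set (vs @ [w]) \<inter> C = insert w (set vs \<inter> C)" using True by auto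
      have "w \<notin> set vs" using w by auto
      then have card: "card (set (vs @ [w]) \<inter> C) = Suc (card (set vs \<inter> C))"
        unfolding ins by simp
      have "card (set vs \<inter> C) \<le> 1" using snoc.IH[OF vs] w Y by blast
      then consider "card (set vs \<inter> C) = 0" | "card (set vs \<inter> C) = 1" by linarith
      then show ?thesis
      proof cases
        case 1
        then show ?thesis using card by simp
      next
        case 2
        then obtain a where a: "set vs \<inter> C = {a}" by (auto simp: card_1_singleton_iff)
        then have "a \<in> C" "a \<in> set vs" by auto
        then obtain X where X: "X \<in> P" "a \<in> X" "neighborhood G a = C - X"
          using multipartite_component_neighborhood[OF C] by metis
        have "X \<noteq> Y" using X Y w \<open>a \<in> set vs\<close> by auto
        then have "X \<inter> Y = {}"
          using C X(1) Y(1) by (auto simp: multipartite_component_def partition_on_def disjoint_def)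
        then have "C \<subseteq> covered (vs @ [w])" using X(3) Y(3) \<open>a \<in> set vs\<close> by auto
        then show ?thesis using card 2 by simp
      qed
    qed
  qed
  then show ?thesis by auto
qed

text \<open>The bounds of two per component add up over the m components.\<close>

lemma multipartite_components_uniform:
  assumes "disjoint_family_on C {..<m}" "pverts G = (\<Union>i<m. C i)"
    and comp: "\<And>i. i < m \<Longrightarrow> multipartite_component (C i) (P i)"
    and ne: "\<And>i. i < m \<Longrightarrow> C i \<noteq> {}"
  shows "total_uniform (2 * m) G"
proof -
  have card: "card A = (\<Sum>i<m. card (A \<inter> C i))" if "A \<subseteq> pverts G" for A
  proof -
    have "A = (\<Union>i<m. A \<inter> C i)" using that assms(2) by auto
    moreover have "card (\<Union>i<m. A \<inter> C i) = (\<Sum>i<m. card (A \<inter> C i))"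
      using assms(1) finite_subset[OF that pair_finite_verts]
      by (intro card_UN_disjoint) (auto simp: disjoint_family_on_def)
    ultimately show ?thesis by simp
  qed
  show ?thesis
  proof (rule total_uniformI)
    fix A assume A: "total_dominating_set G A"
    have "(\<Sum>i<m. 2) \<le> (\<Sum>i<m. card (A \<inter> C i))"
      using multipartite_component_dominating[OF comp ne A] by (intro sum_mono) auto
    then show "2 * m \<le> card A" using card A by (simp add: total_dominating_set_def)
  next
    fix vs assume vs: "legal_sequence G vs"
    have "(\<Sum>i<m. card (set vs \<inter> C i)) \<le> (\<Sum>i<m. 2)"
      using multipartite_component_legal[OF comp vs] by (intro sum_mono) auto
    moreover have "length vs = card (set vs)" "set vs \<subseteq> pverts G"
      using vs by (auto simp: legal_sequence_def distinct_card)
    ultimately show "length vs \<le> 2 * m" using card by simp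
  qed
qed

text \<open>In four consecutive vertices of a long induced cycle, the first and third share a part,
  and so do the second and fourth. These parts differ because the first two vertices are adjacent,
  so there are two large parts.\<close>

lemma multipartite_components_chordal:
  assumes "\<And>v. v \<in> pverts G \<Longrightarrow>
    \<exists>C P. v \<in> C \<and> multipartite_component C P \<and> card {X \<in> P. card X > 1} \<le> 1"
  shows "chordal G"
  unfolding chordal_def
proof (intro notI, elim exE conjE)
  fix c assume cyc: "induced_cycle G c" and len: "4 \<le> length c"
  define n where "n = length c"
  have n: "4 \<le> n" using len n_def by simp
  have adj: "c ! j \<in> neighborhood G (c ! i) \<longleftrightarrow> j = Suc i mod n \<or> i = Suc j mod n"
    if "i < n" "j < n" for i j
    using cyc that unfolding induced_cycle_def n_def neighborhood_def by auto
  \<comment> \<open>Excludes that \<open>c ! 1\<close> follows \<open>c ! 3\<close> by wrapping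
    around.\<close>
  have "4 mod n \<noteq> 1" using n by (cases "n = 4") auto
  then have a: "c ! 1 \<in> neighborhood G (c ! 0)" "c ! 2 \<in> neighborhood G (c ! 1)"
    "c ! 3 \<in> neighborhood G (c ! 2)" "c ! 2 \<notin> neighborhood G (c ! 0)"
    "c ! 3 \<notin> neighborhood G (c ! 1)"
    using n adj[of 0 1] adj[of 1 2] adj[of 2 3] adj[of 0 2] adj[of 1 3] by (auto simp: mod_Suc)
  have "distinct c" "set c \<subseteq> pverts G" using cyc by (auto simp: induced_cycle_def)
  have d: "c ! 0 \<noteq> c ! 2" "c ! 1 \<noteq> c ! 3"
    by (subst nth_eq_iff_index_eq[OF \<open>distinct c\<close>]; use len in linarith)+
  have "c ! 0 \<in> set c" using len by (intro nth_mem) linarith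
  then have "c ! 0 \<in> pverts G" using \<open>set c \<subseteq> pverts G\<close> by blast
  then obtain C P where c0: "c ! 0 \<in> C" and C: "multipartite_component C P"
    and big: "card {X \<in> P. card X > 1} \<le> 1" using assms by blast
  have sub: "neighborhood G u \<subseteq> C" if "u \<in> C" for u
    using multipartite_component_neighborhood[OF C that] by blast
  have c123: "c ! 1 \<in> C" "c ! 2 \<in> C" "c ! 3 \<in> C" using a c0 sub by blast+
  obtain X where X: "X \<in> P" "c ! 0 \<in> X" "X \<subseteq> C" "neighborhood G (c ! 0) = C - X"
    using multipartite_component_neighborhood[OF C c0] .
  obtain Y where Y: "Y \<in> P" "c ! 1 \<in> Y" "Y \<subseteq> C" "neighborhood G (c ! 1) = C - Y"
    using multipartite_component_neighborhood[OF C c123(1)] .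
  have fin: "finite C" using C finite_subset[OF _ pair_finite_verts]
    by (auto simp: multipartite_component_def)
  have two: "card Z > 1" if "x \<in> Z" "y \<in> Z" "x \<noteq> y" "Z \<subseteq> C" for x y Z
    using that card_mono[of Z "{x, y}"] finite_subset[OF _ fin] by auto
  have "card X > 1" using two[of "c ! 0" X "c ! 2"] X a c123 d by blast
  moreover have "card Y > 1" using two[of "c ! 1" Y "c ! 3"] Y a c123 d by blast
  moreover have "X \<noteq> Y" using X Y a by auto
  moreover have "finite {X \<in> P. card X > 1}"
    using C fin finite_elements[of C P] by (auto simp: multipartite_component_def)
  ultimately have "card {X, Y} \<le> card {X \<in> P. card X > 1}"
    using X Y by (intro card_mono) auto
  then show False using big \<open>X \<noteq> Y\<close> by simp
qed

section \<open>Components of total uniform chordal graphs\<close>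

definition split_component :: "'a set \<Rightarrow> bool" where
  "split_component C \<longleftrightarrow>
     (\<exists>P. multipartite_component C P \<and> card P \<ge> 2 \<and> card {X \<in> P. card X > 1} \<le> 1)"

text \<open>Here C is the join of the clique Q and the independent set C - Q. Its parts are the
  singletons of Q and the set C - Q, and only the latter can be large.\<close>

lemma split_componentI:
  assumes "C \<subseteq> pverts G" "Q \<subseteq> C" "Q \<noteq> {}" "C - Q \<noteq> {}"
    and Q: "\<And>q. q \<in> Q \<Longrightarrow> neighborhood G q = C - {q}"
    and R: "\<And>r. r \<in> C - Q \<Longrightarrow> neighborhood G r = Q"
  shows "split_component C"
proof -
  define S where "S = (\<lambda>q. {q}) ` Q"
  define P where "P = insert (C - Q) S"
  have "finite C" using assms(1) pair_finite_verts finite_subset by blast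
  then have "finite Q" using assms(2) finite_subset by blast
  have "partition_on C P"
    using assms(2-4) by (auto simp: P_def S_def partition_on_def disjoint_def)
  moreover have "\<forall>X \<in> P. \<forall>u \<in> X. neighborhood G u = C - X"
    using Q R assms(2) by (auto simp: P_def S_def)
  ultimately have "multipartite_component C P"
    using assms(1) by (simp add: multipartite_component_def)
  moreover have "card P \<ge> 2"
  proof -
    have "card S = card Q" by (simp add: S_def card_image)
    moreover have "C - Q \<notin> S" by (auto simp: S_def)
    ultimately have "card P = Suc (card Q)" using \<open>finite Q\<close> by (simp add: P_def S_def)
    then show ?thesis using assms(3) \<open>finite Q\<close> by (simp add: Suc_le_eq card_gt_0_iff)
  qed
  moreover have "card {X \<in> P. card X > 1} \<le> 1"
  proof -
    have "{X \<in> P. card X > 1} \<subseteq> {C - Q}" by (auto simp: P_def S_def)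
    then have "card {X \<in> P. card X > 1} \<le> card {C - Q}" by (intro card_mono) auto
    then show ?thesis by simp
  qed
  ultimately show ?thesis unfolding split_component_def by blast
qed

lemma total_uniform_simplicial_component:
  assumes unif: "total_uniform k G" and v: "v \<in> pverts G" "simplicial_in (pverts G) v"
    and u: "u \<in> neighborhood G v"
  shows "split_component (insert u (neighborhood G u))"
proof -
  define Q where "Q = neighborhood G v"
  define C where "C = insert u (neighborhood G u)"
  have clique: "b \<in> neighborhood G a" if "a \<in> Q" "b \<in> Q" "a \<noteq> b" for a b
    using v(2) that neighborhood_subset unfolding simplicial_in_def Q_def by blast
  have vQ: "v \<in> neighborhood G q" if "q \<in> Q" for q
    using that neighborhood_sym unfolding Q_def by blast
  have "u \<in> Q" using u Q_def by simp
  have closed: "neighborhood G q \<union> Q = insert q (neighborhood G q)" if "q \<in> Q" for q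
    using clique that by blast
  \<comment> \<open>As Q is a clique containing a, \<open>[v, a]\<close> covers exactly the closed
    neighbourhood of a. The right-hand side is symmetric in a and b, so all vertices of Q have the
    same closed neighbourhood.\<close>
  have twin: "insert a (neighborhood G a) = neighborhood G a \<union> neighborhood G b"
    if "a \<in> Q" "b \<in> Q" "a \<noteq> b" for a b
  proof -
    have legal: "legal_sequence G [v, a]" "legal_sequence G [a, b]"
      using legal_sequence_edge clique that Q_def by auto
    have "covered [v, a] \<subseteq> covered [a, b]"
    proof
      fix x assume "x \<in> covered [v, a]"
      then have "x \<in> insert a (neighborhood G a)" using closed[OF that(1)] Q_def by auto
      moreover have "a \<in> neighborhood G b" using clique that by blast
      ultimately show "x \<in> covered [a, b]" by auto
    qed
    from total_uniform_covered_eq[OF unif legal this] closed[OF that(1)]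
    show ?thesis by (auto simp: Q_def)
  qed
  have eqC: "insert q (neighborhood G q) = C" if "q \<in> Q" for q
    using twin[OF that \<open>u \<in> Q\<close>] twin[OF \<open>u \<in> Q\<close> that] by (cases "q = u") (auto simp: C_def)
  have QC: "Q \<subseteq> C" using eqC by blast
  have "split_component C"
  proof (rule split_componentI[of C Q])
    show "C \<subseteq> pverts G"
      using QC \<open>u \<in> Q\<close> neighborhood_subset unfolding C_def Q_def by blast
    show "C - Q \<noteq> {}"
      using vQ[OF \<open>u \<in> Q\<close>] neighborhood_irrefl unfolding C_def Q_def by blast
    show "neighborhood G q = C - {q}" if "q \<in> Q" for q
      using eqC[OF that] neighborhood_irrefl[of q] by blast
    show "neighborhood G r = Q" if r: "r \<in> C - Q" for r
    proof -
      \<comment> \<open>Thus N(v) = Q is contained in N(r), and comparing the one-element sequences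
        \<open>[v]\<close> and \<open>[r]\<close> turns the inclusion into an equality.\<close>
      have "r \<in> neighborhood G q" if "q \<in> Q" for q using eqC[OF that] r that by blast
      then have "Q \<subseteq> neighborhood G r" using neighborhood_sym by blast
      moreover have "r \<in> pverts G"
        using \<open>C \<subseteq> pverts G\<close> r by blast
      ultimately show ?thesis
        using total_uniform_covered_eq[OF unif legal_sequence_single legal_sequence_single, of v r] v(1)
        by (simp add: Q_def)
    qed
  qed (use QC \<open>u \<in> Q\<close> in auto)
  then show ?thesis by (simp add: C_def)
qed

lemma split_component_closed:
  assumes "split_component C" "c \<in> C"
  shows "neighborhood G c \<subseteq> C"
proof -
  obtain P where "multipartite_component C P" using assms(1) by (auto simp: split_component_def)
  from multipartite_component_neighborhood[OF this assms(2)] show ?thesis by blast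
qed

text \<open>A set W closed under neighbours is a union of components. A vertex simplicial in W is
  simplicial in G, so its component can be split off, and by symmetry of adjacency the rest is
  closed again.\<close>

lemma total_uniform_chordal_components:
  assumes "total_uniform k G" "chordal G" "W \<subseteq> pverts G" "\<And>w. w \<in> W \<Longrightarrow> neighborhood G w \<subseteq> W"
  shows "\<exists>B. finite B \<and> disjoint B \<and> \<Union>B = W \<and> (\<forall>C \<in> B. split_component C)"
  using assms(3,4)
proof (induction "card W" arbitrary: W rule: less_induct)
  case less
  show ?case
  proof (cases "W = {}")
    case True
    then show ?thesis by (intro exI[of _ "{}"]) auto
  next
    case False
    then obtain v where v: "v \<in> W" "simplicial_in W v"
      using chordal_simplicial assms(2) less.prems by blast
    have "neighborhood G v \<inter> W = neighborhood G v \<inter> pverts G"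
      using less.prems v(1) neighborhood_subset by blast
    then have simp: "simplicial_in (pverts G) v" using v(2) by (simp add: simplicial_in_def)
    have vV: "v \<in> pverts G" using v less.prems by blast
    then obtain u where u: "u \<in> neighborhood G v"
      using no_isolated by (auto simp: no_isolated_vertices_def)
    define C where "C = insert u (neighborhood G u)"
    have C: "split_component C"
      using total_uniform_simplicial_component[OF assms(1) vV simp u] by (simp add: C_def)
    have CW: "C \<subseteq> W" using u v(1) less.prems(2) unfolding C_def by blast
    have "finite W" using less.prems(1) pair_finite_verts finite_subset by blast
    then have "card (W - C) < card W" using CW C_def by (intro psubset_card_mono) auto
    moreover have "neighborhood G w \<subseteq> W - C" if "w \<in> W - C" for w
      using that less.prems(2) split_component_closed[OF C] neighborhood_sym by blast
    ultimately obtain B where "finite B" "disjoint B" "\<Union>B = W - C" "\<forall>C \<in> B. split_component C"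
      using less.hyps[of "W - C"] less.prems(1) by blast
    then show ?thesis
      using C CW by (intro exI[of _ "insert C B"]) (auto simp: disjoint_def)
  qed
qed

section \<open>Passing between components and disjoint unions of graphs\<close>

lemma disjoint_union_multipartite_component:
  assumes U: "is_disjoint_union G I H" and "i \<in> I" and mp: "complete_multipartite (H i) P"
    and H: "\<And>j. j \<in> I \<Longrightarrow> pair_graph (H j)"
  shows "multipartite_component (pverts (H i)) P"
proof -
  have part: "partition_on (pverts (H i)) P"
    using mp by (simp add: complete_multipartite_def)
  have arcs: "u \<in> pverts (H j) \<and> v \<in> pverts (H j)" if "j \<in> I" "(u, v) \<in> parcs (H j)" for j u v
  proof -
    interpret Hj: pair_graph "H j" using that(1) by (rule H)
    show ?thesis using that(2) Hj.in_arcsD1 Hj.in_arcsD2 by blast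
  qed
  have "neighborhood G u = pverts (H i) - X" if X: "X \<in> P" "u \<in> X" for X u
  proof -
    have uH: "u \<in> pverts (H i)" using X part by (auto simp: partition_on_def)
    have same: "v \<in> X \<longleftrightarrow> (\<exists>Y \<in> P. u \<in> Y \<and> v \<in> Y)" for v
      using X part unfolding partition_on_def disjoint_def by blast
    \<comment> \<open>An arc at u comes from some \<open>H j\<close> containing u, and disjointness
      leaves only \<open>H i\<close>.\<close>
    have only: "j = i" if "j \<in> I" "u \<in> pverts (H j)" for j
      using U uH that \<open>i \<in> I\<close> by (auto simp: is_disjoint_union_def disjoint_family_on_def)
    have "(u, v) \<in> parcs G \<longleftrightarrow> (\<exists>j \<in> I. (u, v) \<in> parcs (H j))" for v
      using U by (simp add: is_disjoint_union_def)
    then have "(u, v) \<in> parcs G \<longleftrightarrow> (u, v) \<in> parcs (H i)" for v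
      using only arcs \<open>i \<in> I\<close> by metis
    moreover have "(u, v) \<in> parcs (H i) \<longleftrightarrow> v \<notin> X" if "v \<in> pverts (H i)" for v
      using mp uH that unfolding same complete_multipartite_def by simp
    ultimately have "(u, v) \<in> parcs G \<longleftrightarrow> v \<in> pverts (H i) \<and> v \<notin> X" for v
      using arcs[OF \<open>i \<in> I\<close>] by metis
    then show ?thesis by (auto simp: neighborhood_def)
  qed
  then show ?thesis
    using part U \<open>i \<in> I\<close> by (auto simp: multipartite_component_def is_disjoint_union_def)
qed

definition induced :: "'a set \<Rightarrow> 'a pair_pre_digraph" where
  "induced C = \<lparr>pverts = C, parcs = parcs G \<inter> C \<times> C\<rparr>"

lemma pair_graph_induced:
  assumes "C \<subseteq> pverts G"
  shows "pair_graph (induced C)"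
proof -
  have "sym (parcs (induced C))"
    using arcs_symmetric by (auto simp: induced_def sym_def)
  then show ?thesis
    using finite_subset[OF assms pair_finite_verts] pair_finite_arcs pair_no_loops
    by unfold_locales (auto simp: induced_def symmetric_def)
qed

lemma complete_multipartite_induced:
  assumes "multipartite_component C P"
  shows "complete_multipartite (induced C) P"
proof -
  have part: "partition_on C P" and C: "C \<subseteq> pverts G"
    using assms by (auto simp: multipartite_component_def)
  have "(u, v) \<in> parcs (induced C) \<longleftrightarrow> \<not> (\<exists>X \<in> P. u \<in> X \<and> v \<in> X)" if u: "u \<in> C" and v: "v \<in> C" for u v
  proof -
    obtain X where X: "X \<in> P" "u \<in> X" "neighborhood G u = C - X"
      using multipartite_component_neighborhood[OF assms u] by metis
    have "v \<in> X \<longleftrightarrow> (\<exists>Y \<in> P. u \<in> Y \<and> v \<in> Y)"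
      using X part unfolding partition_on_def disjoint_def by blast
    moreover have "(u, v) \<in> parcs (induced C) \<longleftrightarrow> v \<in> neighborhood G u"
      using u v by (simp add: induced_def neighborhood_def)
    ultimately show ?thesis using X(3) v by blast
  qed
  then show ?thesis
    using pair_graph_induced[OF C] part by (simp add: complete_multipartite_def induced_def)
qed

lemma disjoint_union_uniform_chordal:
  assumes U: "is_disjoint_union G {..<m} H"
    and H: "\<And>i. i < m \<Longrightarrow> complete_multipartite (H i) (P i) \<and> card (P i) \<ge> 2 \<and>
      card {X \<in> P i. card X > 1} \<le> 1"
  shows "total_uniform (2 * m) G" "chordal G"
proof -
  have comp: "multipartite_component (pverts (H i)) (P i)" if "i < m" for i
    using disjoint_union_multipartite_component[OF U] H that
    by (auto simp: complete_multipartite_def)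
  \<comment> \<open>An empty vertex set has only the empty partition, contradicting the two parts;
    an empty component would contribute nothing to a dominating set.\<close>
  have ne: "pverts (H i) \<noteq> {}" if "i < m" for i
  proof
    assume "pverts (H i) = {}"
    then have "P i = {}" using comp[OF that] by (auto simp: multipartite_component_def partition_on_def)
    then show False using H[OF that] by simp
  qed
  show "total_uniform (2 * m) G"
    using multipartite_components_uniform[of "\<lambda>i. pverts (H i)" m P] U comp ne
    by (simp add: is_disjoint_union_def)
  show "chordal G"
  proof (rule multipartite_components_chordal)
    fix v assume "v \<in> pverts G"
    then obtain i where "i < m" "v \<in> pverts (H i)" using U by (auto simp: is_disjoint_union_def)
    then show "\<exists>C P. v \<in> C \<and> multipartite_component C P \<and> card {X \<in> P. card X > 1} \<le> 1"
      using comp H by blast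
  qed
qed

lemma total_uniform_chordal_disjoint_union:
  assumes "total_uniform k G" "chordal G"
  obtains m and H :: "nat \<Rightarrow> 'a pair_pre_digraph" where "is_disjoint_union G {..<m} H"
    "\<forall>i<m. \<exists>P. complete_multipartite (H i) P \<and> card P \<ge> 2 \<and> card {X \<in> P. card X > 1} \<le> 1"
proof -
  obtain B where B: "finite B" "disjoint B" "\<Union>B = pverts G" "\<forall>C \<in> B. split_component C"
    using total_uniform_chordal_components[OF assms subset_refl neighborhood_subset] by blast
  \<comment> \<open>The unordered family of components is numbered to match the index set of the
    union; their number is compared with k only later.\<close>
  obtain h where h: "bij_betw h {..<card B} B"
    using ex_bij_betw_nat_finite[OF B(1)] by (auto simp: atLeast0LessThan)
  have hB: "h i \<in> B" if "i < card B" for i using h that by (auto simp: bij_betw_def)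
  have img: "h ` {..<card B} = B" using h by (simp add: bij_betw_def)
  have "h i \<inter> h j = {}" if "i < card B" "j < card B" "i \<noteq> j" for i j
  proof -
    have "h i \<noteq> h j" using h that by (auto simp: bij_betw_def inj_on_def)
    then show ?thesis using B(2) hB that by (simp add: disjoint_def)
  qed
  then have "disjoint_family_on (\<lambda>i. pverts (induced (h i))) {..<card B}"
    by (simp add: disjoint_family_on_def induced_def)
  moreover have verts: "pverts G = (\<Union>i<card B. pverts (induced (h i)))"
    using B(3) img by (simp add: induced_def)
  moreover have "parcs G = (\<Union>i<card B. parcs (induced (h i)))"
  proof
    show "parcs G \<subseteq> (\<Union>i<card B. parcs (induced (h i)))"
    proof (rule subrelI)
      fix u v assume uv: "(u, v) \<in> parcs G"
      then have "u \<in> pverts G" by (rule in_arcsD1)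
      then obtain i where i: "i < card B" "u \<in> h i" using verts by (auto simp: induced_def)
      then have "v \<in> h i"
        using split_component_closed[of "h i" u] B(4) hB uv by (auto simp: neighborhood_def)
      then show "(u, v) \<in> (\<Union>i<card B. parcs (induced (h i)))"
        using i uv by (auto simp: induced_def)
    qed
  qed (auto simp: induced_def)
  ultimately have "is_disjoint_union G {..<card B} (\<lambda>i. induced (h i))"
    by (simp add: is_disjoint_union_def)
  moreover have "\<forall>i<card B. \<exists>P. complete_multipartite (induced (h i)) P \<and> card P \<ge> 2 \<and>
      card {X \<in> P. card X > 1} \<le> 1"
    using B(4) hB complete_multipartite_induced unfolding split_component_def by blast
  ultimately show thesis by (rule that)
qed

end

theorem theorem5p3:
  fixes G :: "'a pair_pre_digraph" and k :: nat
  assumes "pair_graph G"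
    and "no_isolated_vertices G"
    and "k > 0"
  shows "total_uniform k G \<and> chordal G \<longleftrightarrow>
    even k \<and>
    (\<exists>H :: nat \<Rightarrow> 'a pair_pre_digraph.
       is_disjoint_union G {..<k div 2} H \<and>
       (\<forall>i < k div 2. \<exists>P. complete_multipartite (H i) P \<and> card P \<ge> 2 \<and>
          card {X \<in> P. card X > 1} \<le> 1))"
  (is "_ \<longleftrightarrow> even k \<and> ?union (k div 2)")
proof -
  interpret graph_without_isolated G
    using assms(1,2) by (simp add: graph_without_isolated_def graph_without_isolated_axioms_def)
  \<comment> \<open>Proved for arbitrary m, since it serves twice: for the backward direction, and
    in the forward one to identify the number of components from k = 2m.\<close>
  have converse: "total_uniform (2 * m) G \<and> chordal G" if "?union m" for m
  proof -
    from that obtain H P where "is_disjoint_union G {..<m} H"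
      "\<And>i. i < m \<Longrightarrow> complete_multipartite (H i) (P i) \<and> card (P i) \<ge> 2 \<and>
        card {X \<in> P i. card X > 1} \<le> 1" by metis
    then show ?thesis using disjoint_union_uniform_chordal by blast
  qed
  show ?thesis
  proof
    assume unif: "total_uniform k G \<and> chordal G"
    then have "total_uniform k G" "chordal G" by auto
    then obtain m and H :: "nat \<Rightarrow> 'a pair_pre_digraph" where "is_disjoint_union G {..<m} H"
      "\<forall>i<m. \<exists>P. complete_multipartite (H i) P \<and> card P \<ge> 2 \<and> card {X \<in> P. card X > 1} \<le> 1"
      by (rule total_uniform_chordal_disjoint_union)
    then have m: "?union m" by blast
    from converse[OF m] unif have "k = 2 * m" by (simp add: total_uniform_def)
    then show "even k \<and> ?union (k div 2)" using m by simp
  next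
    assume "even k \<and> ?union (k div 2)"
    then show "total_uniform k G \<and> chordal G" using converse[of "k div 2"] by simp
  qed
qed

end
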